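(* Let $\mathcal{X} = \{\mathbf{x} \in \mathbb{Z}^{n-q}\times\mathbb{R}^{q} : \mathbf{A}\mathbf{x} \geq \mathbf{b}\}$ be a mixed integer linear feasible region and let $\hat{\mathbf{x}} \in \mathcal{X}$. Let $\mathcal{G} \subseteq \mathbb{R}^n$, where the generated cones $\mathcal{Y}(\hat{\mathbf{x}},\mathcal{X})$ and $\mathcal{Y}(\hat{\mathbf{x}},\mathcal{G})$ are polyhedral. Then $\mathcal{G}$ is a generator set for $\mathcal{X}$ (with respect to $\hat{\mathbf{x}}$), i.e. $\mathcal{C}(\hat{\mathbf{x}},\mathcal{G}) = \mathcal{C}(\hat{\mathbf{x}},\mathcal{X})$, if and only if $\mathcal{Y}(\hat{\mathbf{x}},\mathcal{X}) = \mathcal{Y}(\hat{\mathbf{x}},\mathcal{G})$.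
   Context: Here $0\le q\le n$ are integers, $\mathbf{A}$ is a real matrix with $n$ columns and $\mathbf{b}$ a real vector of matching dimension. The forward problem is to minimize $\mathbf{c}^\top\mathbf{x}$ over $\mathbf{x}\in\mathcal{X}$. For any set $\mathcal{S}\subseteq\mathbb{R}^n$, the inverse-feasible region is $\mathcal{C}(\hat{\mathbf{x}},\mathcal{S}) := \{\mathbf{c}\in\mathbb{R}^n : \mathbf{c}^\top(\hat{\mathbf{x}}-\mathbf{x}) \leq 0 \ \text{for all } \mathbf{x}\in\mathcal{S}\}$. (For $\mathcal{S}=\mathcal{X}$ this is the set of all cost vectors for which $\hat{\mathbf{x}}$ is an optimal solution of the forward problem.) A set $\mathcal{G}\subseteq\mathbb{R}^n$ is a generator set for $\mathcal{X}$ if $\mathcal{C}(\hat{\mathbf{x}},\mathcal{G}) = \mathcal{C}(\hat{\mathbf{x}},\mathcal{X})$. For $\mathcal{S}\subseteq\mathbb{R}^n$, $\mathcal{Y}(\hat{\mathbf{x}},\mathcal{S})$ denotes the convex cone with apex $\hat{\mathbf{x}}$ generated by the points of $\mathcal{S}$: $\mathcal{Y}(\hat{\mathbf{x}},\mathcal{S}) = \{\hat{\mathbf{x}} + \sum_{i=1}^{k}\lambda_i(\mathbf{x}^i-\hat{\mathbf{x}}) : k\geq 0,\ \mathbf{x}^i\in\mathcal{S},\ \lambda_i\geq 0\}$. It is called polyhedral if it is a polyhedron (the solution set of finitely many linear inequalities). *)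

theory Defs
  imports "HOL-Analysis.Analysis"
begin

(* The integer coordinates form an arbitrary index set I, so no order on the index
   type is needed; Z^(n-q) x R^q corresponds to card I = n - q. *)
definition mixed_integer_region ::
  "'n set \<Rightarrow> real ^ 'n ^ 'm \<Rightarrow> real ^ 'm \<Rightarrow> (real ^ 'n) set" where
  "mixed_integer_region I A b = {x. (\<forall>i\<in>I. x $ i \<in> \<int>) \<and> A *v x \<ge> b}"

definition inverse_feasible :: "real ^ 'n \<Rightarrow> (real ^ 'n) set \<Rightarrow> (real ^ 'n) set" where
  "inverse_feasible xhat S = {c. \<forall>x\<in>S. c \<bullet> (xhat - x) \<le> 0}"

definition generator_set :: "real ^ 'n \<Rightarrow> (real ^ 'n) set \<Rightarrow> (real ^ 'n) set \<Rightarrow> bool" where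
  "generator_set xhat X G \<longleftrightarrow> inverse_feasible xhat G = inverse_feasible xhat X"

(* k = 0 is allowed, so the apex always belongs to the cone, even if S is empty. *)
definition generated_cone :: "real ^ 'n \<Rightarrow> (real ^ 'n) set \<Rightarrow> (real ^ 'n) set" where
  "generated_cone xhat S =
     {xhat + (\<Sum>i<k. l i *\<^sub>R (x i - xhat)) | (k::nat) (l :: nat \<Rightarrow> real) (x :: nat \<Rightarrow> real ^ 'n).
        \<forall>i<k. x i \<in> S \<and> l i \<ge> 0}"

end

theory Submission
  imports Defs
begin

text \<open>
  The set of inverse-feasible cost vectors is, up to sign, the polar of the cone generated at the
  apex: an inequality \<open>c \<bullet> (xhat - x) \<le> 0\<close> that holds at the generators passes to their
  nonnegative combinations, so replacing \<open>S\<close> by its generated cone does not change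
  \<open>inverse_feasible xhat S\<close>. Hence equal cones give equal inverse-feasible regions. Conversely, a
  closed generated cone can be recovered from its polar (the bipolar theorem, by separating an
  outside point from the cone), so equal regions give equal cones. Polyhedra are closed, and this is
  how the polyhedrality of the two cones enters.
\<close>

lemma generated_coneE:
  assumes "y \<in> generated_cone xhat S"
  obtains k :: nat and l x where "y = xhat + (\<Sum>i<k. l i *\<^sub>R (x i - xhat))"
    and "\<And>i. i < k \<Longrightarrow> x i \<in> S" and "\<And>i. i < k \<Longrightarrow> 0 \<le> l i"
  using assms unfolding generated_cone_def by blast

lemma generated_coneI:
  fixes k :: nat
  assumes "\<And>i. i < k \<Longrightarrow> x i \<in> S" and "\<And>i. i < k \<Longrightarrow> 0 \<le> l i"
  shows "xhat + (\<Sum>i<k. l i *\<^sub>R (x i - xhat)) \<in> generated_cone xhat S"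
  using assms unfolding generated_cone_def by blast

lemma apex_in_generated_cone: "xhat \<in> generated_cone xhat S"
  using generated_coneI[of 0] by simp

lemma subset_generated_cone: "S \<subseteq> generated_cone xhat S"
proof
  fix y assume "y \<in> S"
  then show "y \<in> generated_cone xhat S"
    using generated_coneI[of 1 "\<lambda>_. y" S "\<lambda>_. 1" xhat] by simp
qed

lemma generated_cone_combination:
  assumes "y \<in> generated_cone xhat S" "z \<in> generated_cone xhat S" and "0 \<le> s" "0 \<le> t"
  shows "xhat + s *\<^sub>R (y - xhat) + t *\<^sub>R (z - xhat) \<in> generated_cone xhat S"
proof -
  obtain k :: nat and l x where y: "y = xhat + (\<Sum>i<k. l i *\<^sub>R (x i - xhat))"
    and k: "\<And>i. i < k \<Longrightarrow> x i \<in> S" "\<And>i. i < k \<Longrightarrow> 0 \<le> l i"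
    using assms(1) by (rule generated_coneE) (rule that)
  obtain m :: nat and l' x' where z: "z = xhat + (\<Sum>i<m. l' i *\<^sub>R (x' i - xhat))"
    and m: "\<And>i. i < m \<Longrightarrow> x' i \<in> S" "\<And>i. i < m \<Longrightarrow> 0 \<le> l' i"
    using assms(2) by (rule generated_coneE) (rule that)
  define u where "u i = (if i < k then s * l i else t * l' (i - k))" for i
  define w where "w i = (if i < k then x i else x' (i - k))" for i
  have "(\<Sum>i<k + m. u i *\<^sub>R (w i - xhat))
      = (\<Sum>i<k. u i *\<^sub>R (w i - xhat)) + (\<Sum>i<m. u (k + i) *\<^sub>R (w (k + i) - xhat))"
    by (induction m) (simp_all add: add.assoc)
  also have "\<dots> = s *\<^sub>R (y - xhat) + t *\<^sub>R (z - xhat)"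
    by (simp add: u_def w_def y z scaleR_sum_right)
  finally have "xhat + s *\<^sub>R (y - xhat) + t *\<^sub>R (z - xhat)
      = xhat + (\<Sum>i<k + m. u i *\<^sub>R (w i - xhat))"
    by simp
  moreover have "xhat + (\<Sum>i<k + m. u i *\<^sub>R (w i - xhat)) \<in> generated_cone xhat S"
    using k m assms(3,4) by (intro generated_coneI) (auto simp: u_def w_def)
  ultimately show ?thesis
    by (simp only:)
qed

lemma generated_cone_ray:
  assumes "y \<in> generated_cone xhat S" and "0 \<le> t"
  shows "xhat + t *\<^sub>R (y - xhat) \<in> generated_cone xhat S"
  using generated_cone_combination[OF assms(1) apex_in_generated_cone assms(2) order_refl] by simp

lemma convex_generated_cone: "convex (generated_cone xhat S)"
proof (rule convexI)
  fix y z and s t :: real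
  assume *: "y \<in> generated_cone xhat S" "z \<in> generated_cone xhat S" "0 \<le> s" "0 \<le> t" "s + t = 1"
  have "xhat + s *\<^sub>R (y - xhat) + t *\<^sub>R (z - xhat) = s *\<^sub>R y + t *\<^sub>R z + (1 - (s + t)) *\<^sub>R xhat"
    by (simp add: algebra_simps)
  then show "s *\<^sub>R y + t *\<^sub>R z \<in> generated_cone xhat S"
    using generated_cone_combination[OF *(1-4)] *(5) by simp
qed

text \<open>This is the invariance of the polar under passing to the generated cone: the defining
  inequality is linear in the displacement from the apex, so it extends from the generators to all
  their nonnegative combinations.\<close>

lemma inverse_feasible_generated_cone:
  "inverse_feasible xhat (generated_cone xhat S) = inverse_feasible xhat S"
proof
  show "inverse_feasible xhat (generated_cone xhat S) \<subseteq> inverse_feasible xhat S"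
    using subset_generated_cone unfolding inverse_feasible_def by blast
next
  show "inverse_feasible xhat S \<subseteq> inverse_feasible xhat (generated_cone xhat S)"
  proof
    fix c assume c: "c \<in> inverse_feasible xhat S"
    have "c \<bullet> (xhat - y) \<le> 0" if "y \<in> generated_cone xhat S" for y
      using that
    proof (rule generated_coneE)
      fix k :: nat and l x
      assume y: "y = xhat + (\<Sum>i<k. l i *\<^sub>R (x i - xhat))"
        and x: "\<And>i. i < k \<Longrightarrow> x i \<in> S" and l: "\<And>i. i < k \<Longrightarrow> 0 \<le> l i"
      have "0 \<le> c \<bullet> (x i - xhat)" if "i < k" for i
        using c x[OF that] by (auto simp: inverse_feasible_def inner_diff_right)
      then have "0 \<le> (\<Sum>i<k. l i * (c \<bullet> (x i - xhat)))"
        using l by (intro sum_nonneg) auto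
      then show ?thesis
        by (simp add: y inner_sum_right)
    qed
    then show "c \<in> inverse_feasible xhat (generated_cone xhat S)"
      by (simp add: inverse_feasible_def)
  qed
qed

text \<open>This is the bipolar theorem for cones with apex \<open>xhat\<close>. A hyperplane that strictly separates a
  point from the cone has a normal that is itself inverse-feasible: were it negative along some ray
  of the cone, it would be unbounded below on the cone.\<close>

lemma closed_generated_cone_bipolar:
  assumes "closed (generated_cone xhat S)"
  shows "generated_cone xhat S = {y. \<forall>c\<in>inverse_feasible xhat S. c \<bullet> (xhat - y) \<le> 0}"
proof
  show "generated_cone xhat S \<subseteq> {y. \<forall>c\<in>inverse_feasible xhat S. c \<bullet> (xhat - y) \<le> 0}"
    using inverse_feasible_generated_cone[of xhat S] unfolding inverse_feasible_def by blast
next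
  show "{y. \<forall>c\<in>inverse_feasible xhat S. c \<bullet> (xhat - y) \<le> 0} \<subseteq> generated_cone xhat S"
  proof (rule ccontr)
    assume "\<not> ?thesis"
    then obtain z where z: "\<And>c. c \<in> inverse_feasible xhat S \<Longrightarrow> c \<bullet> (xhat - z) \<le> 0"
      and notin: "z \<notin> generated_cone xhat S"
      by blast
    obtain c \<beta> where less: "c \<bullet> z < \<beta>" and greater: "\<And>y. y \<in> generated_cone xhat S \<Longrightarrow> \<beta> < c \<bullet> y"
      using separating_hyperplane_closed_point[OF convex_generated_cone assms notin] by blast
    have "c \<bullet> (xhat - x) \<le> 0" if "x \<in> S" for x
    proof (rule ccontr)
      assume "\<not> ?thesis"
      then have pos: "0 < c \<bullet> (xhat - x)" by simp
      \<comment> \<open>the parameter at which the ray through \<open>x\<close> reaches the separating hyperplane\<close>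
      define t where "t = (c \<bullet> xhat - \<beta>) / (c \<bullet> (xhat - x))"
      have "0 \<le> t"
        using pos greater[OF apex_in_generated_cone] by (simp add: t_def)
      then have "\<beta> < c \<bullet> (xhat + t *\<^sub>R (x - xhat))"
        using greater generated_cone_ray subset_generated_cone that by blast
      also have "\<dots> = c \<bullet> xhat - t * (c \<bullet> (xhat - x))"
        by (simp add: inner_add_right inner_diff_right algebra_simps)
      also have "\<dots> = \<beta>"
        using pos by (simp add: t_def)
      finally show False by simp
    qed
    then have "c \<bullet> (xhat - z) \<le> 0"
      using z by (simp add: inverse_feasible_def)
    then show False
      using less greater[OF apex_in_generated_cone] by (simp add: inner_diff_right)
  qed
qed

theorem theorem1:
  fixes A :: "real ^ 'n ^ 'm" and b :: "real ^ 'm"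
    and q :: nat and I :: "'n set"
    and X G :: "(real ^ 'n) set" and xhat :: "real ^ 'n"
  assumes "q \<le> CARD('n)" and "card I = CARD('n) - q"
    and "X = mixed_integer_region I A b"
    and "xhat \<in> X"
    and "polyhedron (generated_cone xhat X)"
    and "polyhedron (generated_cone xhat G)"
  shows "generator_set xhat X G \<longleftrightarrow> generated_cone xhat X = generated_cone xhat G"
proof
  assume "generator_set xhat X G"
  then show "generated_cone xhat X = generated_cone xhat G"
    using closed_generated_cone_bipolar[OF polyhedron_imp_closed[OF assms(5)]]
      closed_generated_cone_bipolar[OF polyhedron_imp_closed[OF assms(6)]]
    by (simp add: generator_set_def)
next
  assume "generated_cone xhat X = generated_cone xhat G"
  then show "generator_set xhat X G"
    using inverse_feasible_generated_cone[of xhat X] inverse_feasible_generated_cone[of xhat G]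
    by (simp add: generator_set_def)
qed

end
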